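(* Consider the 2-person linear-quadratic dynamic game with feedback information pattern, player 1 as leader and player 2 as follower: for $k\in K=\{1,\dots,T\}$, $$x_{k+1}=A_kx_k+B_k^1u_k^1+B_k^2u_k^2,\quad x_1\text{ given},\qquad L^i=\sum_{k=1}^T\tfrac12\big(x_{k+1}'Q_{k+1}^ix_{k+1}+u_k^{i'}u_k^i+u_k^{j'}R_k^{ij}u_k^j\big),\quad i,j\in\{1,2\},\ j\ne i,$$ where $Q_{k+1}^i\ge0$ and $R_k^{ij}\ge0$ for all $k\in K$, $i,j\in\{1,2\}$, $j\ne i$. Then the unique feedback Stackelberg equilibrium strategies can be written as $$\gamma_k^{i*}(x_k)=-S_k^ix_k,\qquad i\in\{1,2\},\ k\in K,$$ where $$S_k^1=\Big[B_k^{1'}(I+L_{k+1}^2B_k^2B_k^{2'})^{-1}L_{k+1}^1(I+B_k^2B_k^{2'}L_{k+1}^2)^{-1}B_k^1+B_k^{1'}L_{k+1}^2B_k^2(I+B_k^{2'}L_{k+1}^2B_k^2)^{-1}R_k^{12}(I+B_k^{2'}L_{k+1}^2B_k^2)^{-1}B_k^{2'}L_{k+1}^2B_k^1+I\Big]^{-1}$$ $$\times B_k^{1'}\Big[(I+L_{k+1}^2B_k^2B_k^{2'})^{-1}L_{k+1}^1(I+B_k^2B_k^{2'}L_{k+1}^2)^{-1}+L_{k+1}^2B_k^2(I+B_k^{2'}L_{k+1}^2B_k^2)^{-1}R_k^{12}(I+B_k^{2'}L_{k+1}^2B_k^2)^{-1}B_k^{2'}L_{k+1}^2\Big]A_k,$$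 $$S_k^2=(I+B_k^{2'}L_{k+1}^2B_k^2)^{-1}B_k^{2'}L_{k+1}^2(A_k-B_k^1S_k^1),$$ $$L_k^i=(A_k-B_k^iS_k^i-B_k^jS_k^j)'L_{k+1}^i(A_k-B_k^iS_k^i-B_k^jS_k^j)+S_k^{i'}S_k^i+S_k^{j'}R_k^{ij}S_k^j+Q_k^i,\qquad L_{T+1}^i=Q_{T+1}^i,\quad i,j\in\{1,2\},\ j\ne i.$$
   Context: A prime denotes transpose; for symmetric matrices $\ge0$ means positive semidefinite. States $x_k\in\mathbb R^p$, controls $u_k^i\in\mathbb R^{m_i}$; $A_k,B_k^i,Q_k^i,R_k^{ij}$ are given of appropriate dimensions, with $Q_k^i,R_k^{ij}$ symmetric. Convention: $Q_1^i:=0$ (the cost contains no term in $x_1$). $L^i$ denotes cost functionals, $L_k^i$ matrices. Feedback information: at stage $k$ the players know $x_k$ and use $u_k^i=\gamma_k^i(x_k)$. Feedback Stackelberg equilibrium (leader 1): strategies for which there are functions $V^i(k,\cdot)$ with $V^i(T+1,\cdot)=0$ such that, with $y=A_kx+B_k^1u^1+B_k^2u^2$ and $J_k^i(x,u^1,u^2)=\tfrac12(y'Q_{k+1}^iy+u^{i'}u^i+u^{j'}R_k^{ij}u^j)+V^i(k+1,y)$, for all $k\in K$, $x$: (a) for each $u^1$ there is a unique minimizer $r_k(u^1)$ of $u^2\mapsto J_k^2(x,u^1,u^2)$; (b) $\gamma_k^{1*}(x)$ minimizes $u^1\mapsto J_k^1(x,u^1,r_k(u^1))$; (c) $\gamma_k^{2*}(x)=r_k(\gamma_k^{1*}(x))$;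 (d) $V^i(k,x)=J_k^i(x,\gamma_k^{1*}(x),\gamma_k^{2*}(x))$. *)

theory Defs
  imports "HOL-Analysis.Analysis"
begin

definition sym_psd :: "real^'n^'n \<Rightarrow> bool" where
  "sym_psd M \<longleftrightarrow> transpose M = M \<and> (\<forall>x. 0 \<le> x \<bullet> (M *v x))"

text \<open>The stage cost of a player who uses the control \<open>u\<close> while the opponent uses \<open>v\<close>;
  \<open>y\<close> is the successor state.\<close>

definition stage_cost ::
  "real^'p^'p \<Rightarrow> real^'n^'n \<Rightarrow> real^'p \<Rightarrow> real^'m \<Rightarrow> real^'n \<Rightarrow> real" where
  "stage_cost Q R y u v = (y \<bullet> (Q *v y) + u \<bullet> u + v \<bullet> (R *v v)) / 2"

text \<open>Player 1 is the leader. The cost-to-go functions \<open>V1 k\<close>, \<open>V2 k\<close> count only the costs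
  of the stages \<open>k, ..., T\<close>, so they contain no term in the state at stage \<open>k\<close> weighted
  by \<open>Q1 k\<close>, \<open>Q2 k\<close>. For the given \<open>k\<close> and \<open>x\<close>, \<open>r\<close> is the reaction function
  of the follower.\<close>

definition feedback_stackelberg ::
  "nat \<Rightarrow> (nat \<Rightarrow> real^'p^'p) \<Rightarrow> (nat \<Rightarrow> real^'m1^'p) \<Rightarrow> (nat \<Rightarrow> real^'m2^'p) \<Rightarrow>
   (nat \<Rightarrow> real^'p^'p) \<Rightarrow> (nat \<Rightarrow> real^'p^'p) \<Rightarrow>
   (nat \<Rightarrow> real^'m2^'m2) \<Rightarrow> (nat \<Rightarrow> real^'m1^'m1) \<Rightarrow>
   (nat \<Rightarrow> real^'p \<Rightarrow> real^'m1) \<Rightarrow> (nat \<Rightarrow> real^'p \<Rightarrow> real^'m2) \<Rightarrow> bool" where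
  "feedback_stackelberg T A B1 B2 Q1 Q2 R12 R21 \<gamma>1 \<gamma>2 \<longleftrightarrow>
    (\<exists>V1 V2 :: nat \<Rightarrow> real^'p \<Rightarrow> real.
      (\<forall>x. V1 (T + 1) x = 0) \<and> (\<forall>x. V2 (T + 1) x = 0) \<and>
      (\<forall>k\<in>{1..T}. \<forall>x.
        let next_state = (\<lambda>u1 u2. A k *v x + B1 k *v u1 + B2 k *v u2);
            J1 = (\<lambda>u1 u2. stage_cost (Q1 (k + 1)) (R12 k) (next_state u1 u2) u1 u2
                          + V1 (k + 1) (next_state u1 u2));
            J2 = (\<lambda>u1 u2. stage_cost (Q2 (k + 1)) (R21 k) (next_state u1 u2) u2 u1
                          + V2 (k + 1) (next_state u1 u2))
        in \<exists>r. (\<forall>u1 u2. is_arg_min (J2 u1) (\<lambda>_. True) u2 \<longleftrightarrow> u2 = r u1) \<and>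
               is_arg_min (\<lambda>u1. J1 u1 (r u1)) (\<lambda>_. True) (\<gamma>1 k x) \<and>
               \<gamma>2 k x = r (\<gamma>1 k x) \<and>
               V1 k x = J1 (\<gamma>1 k x) (\<gamma>2 k x) \<and>
               V2 k x = J2 (\<gamma>1 k x) (\<gamma>2 k x)))"

text \<open>In the gains at stage \<open>k\<close>, \<open>A\<close>, \<open>B1\<close>, \<open>B2\<close> and \<open>R12\<close> are the data
  at stage \<open>k\<close>, while \<open>L1\<close> and \<open>L2\<close> belong to stage \<open>k + 1\<close>.\<close>

definition leader_bracket ::
  "real^'m1^'p \<Rightarrow> real^'m2^'p \<Rightarrow> real^'m2^'m2 \<Rightarrow> real^'p^'p \<Rightarrow> real^'p^'p \<Rightarrow> real^'m1^'m1" where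
  "leader_bracket B1 B2 R12 L1 L2 =
     transpose B1 ** matrix_inv (mat 1 + L2 ** B2 ** transpose B2) ** L1
       ** matrix_inv (mat 1 + B2 ** transpose B2 ** L2) ** B1
     + transpose B1 ** L2 ** B2 ** matrix_inv (mat 1 + transpose B2 ** L2 ** B2) ** R12
       ** matrix_inv (mat 1 + transpose B2 ** L2 ** B2) ** transpose B2 ** L2 ** B1
     + mat 1"

definition leader_gain ::
  "real^'p^'p \<Rightarrow> real^'m1^'p \<Rightarrow> real^'m2^'p \<Rightarrow> real^'m2^'m2 \<Rightarrow> real^'p^'p \<Rightarrow> real^'p^'p
   \<Rightarrow> real^'p^'m1" where
  "leader_gain A B1 B2 R12 L1 L2 =
     matrix_inv (leader_bracket B1 B2 R12 L1 L2) ** transpose B1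
     ** (matrix_inv (mat 1 + L2 ** B2 ** transpose B2) ** L1
           ** matrix_inv (mat 1 + B2 ** transpose B2 ** L2)
         + L2 ** B2 ** matrix_inv (mat 1 + transpose B2 ** L2 ** B2) ** R12
           ** matrix_inv (mat 1 + transpose B2 ** L2 ** B2) ** transpose B2 ** L2)
     ** A"

definition follower_gain ::
  "real^'p^'p \<Rightarrow> real^'m1^'p \<Rightarrow> real^'m2^'p \<Rightarrow> real^'p^'p \<Rightarrow> real^'p^'m1 \<Rightarrow> real^'p^'m2" where
  "follower_gain A B1 B2 L2 S1 =
     matrix_inv (mat 1 + transpose B2 ** L2 ** B2) ** transpose B2 ** L2 ** (A - B1 ** S1)"

text \<open>\<open>F\<close> is the closed-loop matrix, \<open>S\<close> the player's own gain, \<open>S'\<close> the opponent's.\<close>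

definition cost_step ::
  "real^'p^'p \<Rightarrow> real^'n^'n \<Rightarrow> real^'p^'p \<Rightarrow> real^'p^'m \<Rightarrow> real^'p^'n \<Rightarrow> real^'p^'p
   \<Rightarrow> real^'p^'p" where
  "cost_step Q R F S S' L =
     transpose F ** L ** F + transpose S ** S + transpose S' ** R ** S' + Q"

end

theory Submission
  imports Defs
begin

text \<open>
  The cost-to-go of player \<open>i\<close> from stage \<open>k\<close> is the quadratic form of
  \<open>(L\<^sup>i\<^sub>k - Q\<^sup>i\<^sub>k) / 2\<close>; adding the state cost of stage \<open>k\<close> turns it into the form of
  \<open>L\<^sup>i\<^sub>k / 2\<close>, which is positive semidefinite. At each stage both players therefore solve a
  problem of the same type: minimize \<open>(z + B u)' L (z + B u) + u' u\<close> over \<open>u\<close>, with \<open>L\<close>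
  positive semidefinite. Completing the square gives the unique minimizer
  \<open>u = - (I + B' L B)\<^sup>-\<^sup>1 B' L z\<close>. For the follower, \<open>L = L\<^sup>2\<^sub>k\<^sub>+\<^sub>1\<close>. If \<open>K\<close> is the resulting
  gain, the successor state is \<open>(I - B\<^sup>2 K) z = (I + B\<^sup>2 B\<^sup>2' L\<^sup>2)\<^sup>-\<^sup>1 z\<close>, so the leader faces
  the weight \<open>W = (I - B\<^sup>2 K)' L\<^sup>1 (I - B\<^sup>2 K) + K' R\<^sup>1\<^sup>2 K\<close>.
\<close>

section \<open>Positive semidefinite matrices and inverses\<close>

lemma matrix_add_rdistrib: "(M + N) ** P = M ** P + N ** P"
  by (simp add: matrix_matrix_mult_def vec_eq_iff distrib_right sum.distrib)

lemma transpose_add: "transpose (M + N) = transpose M + transpose (N :: real^'n^'m)"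
  by (simp add: transpose_def vec_eq_iff)

lemma inner_transpose: "x \<bullet> (transpose M *v y) = (M *v x) \<bullet> y"
  for M :: "real^'n^'m"
  by (metis dot_lmul_matrix inner_commute transpose_matrix_vector)

lemma sym_psd_inner_commute:
  assumes "sym_psd M"
  shows "x \<bullet> (M *v y) = y \<bullet> (M *v x)"
  using assms inner_transpose[of x M y]
  by (simp add: sym_psd_def inner_commute del: transpose_matrix_vector)

lemma sym_psd_add: "sym_psd M \<Longrightarrow> sym_psd N \<Longrightarrow> sym_psd (M + N)"
  by (simp add: sym_psd_def transpose_add matrix_vector_mult_add_rdistrib inner_add_right)

lemma inner_congruence:
  "x \<bullet> ((transpose B ** M ** B) *v x) = (B *v x) \<bullet> (M *v (B *v x))"
  for B :: "real^'n^'m"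
  by (simp add: inner_transpose del: transpose_matrix_vector flip: matrix_vector_mul_assoc)

lemma sym_psd_congruence: "sym_psd M \<Longrightarrow> sym_psd (transpose B ** M ** B)"
  unfolding sym_psd_def by (simp add: matrix_transpose_mul matrix_mul_assoc inner_congruence)

lemma sym_psd_gram: "sym_psd (transpose B ** B)"
  using sym_psd_congruence[of "mat 1" B] by (simp add: sym_psd_def)

text \<open>A kernel vector satisfies \<open>x \<bullet> x + x \<bullet> (M *v x) = 0\<close> with
  both summands nonnegative, so it vanishes.\<close>

lemma invertible_mat_1_plus_sym_psd:
  assumes "sym_psd M"
  shows "invertible (mat 1 + M)"
proof -
  have "x = 0" if "(mat 1 + M) *v x = 0" for x
  proof -
    have "x \<bullet> x + x \<bullet> (M *v x) = x \<bullet> ((mat 1 + M) *v x)"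
      by (simp add: matrix_vector_mult_add_rdistrib inner_add_right)
    then have "x \<bullet> x + x \<bullet> (M *v x) = 0"
      using that by simp
    moreover have "0 \<le> x \<bullet> (M *v x)"
      using assms by (simp add: sym_psd_def)
    ultimately have "x \<bullet> x \<le> 0"
      by linarith
    then show ?thesis
      by (metis inner_eq_zero_iff inner_ge_zero order_antisym)
  qed
  then show ?thesis
    by (simp add: invertible_left_inverse matrix_left_invertible_ker)
qed

lemma invertible_matrix_inv:
  assumes "invertible M"
  shows "M ** matrix_inv M = mat 1" "matrix_inv M ** M = mat 1"
  using someI_ex[OF assms[unfolded invertible_def]] by (simp_all add: matrix_inv_def)

lemma matrix_inv_eqI:
  fixes M N :: "real^'n^'n"
  assumes "M ** N = mat 1"
  shows "invertible M" "matrix_inv M = N"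
proof -
  show inv: "invertible M"
    using assms invertible_right_inverse by blast
  have "matrix_inv M ** (M ** N) = N"
    by (simp add: matrix_mul_assoc invertible_matrix_inv[OF inv])
  then show "matrix_inv M = N"
    by (simp add: assms)
qed

lemma transpose_matrix_inv:
  fixes M :: "real^'n^'n"
  assumes "invertible M"
  shows "transpose (matrix_inv M) = matrix_inv (transpose M)"
proof (rule matrix_inv_eqI(2)[symmetric])
  show "transpose M ** transpose (matrix_inv M) = mat 1"
    by (simp add: invertible_matrix_inv[OF assms] flip: matrix_transpose_mul)
qed

section \<open>The one-player linear-quadratic problem\<close>

definition regulator_gain :: "real^'p^'p \<Rightarrow> real^'m^'p \<Rightarrow> real^'p^'m" where
  "regulator_gain L B = matrix_inv (mat 1 + transpose B ** L ** B) ** transpose B ** L"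

text \<open>The term \<open>u \<bullet> u\<close> makes the cost strictly convex even where
  \<open>L\<close> is degenerate, hence uniqueness. The constant \<open>c\<close> absorbs costs free
  of \<open>u\<close>, such as the follower's cost of the leader's control.\<close>

lemma is_arg_min_regulator:
  assumes L: "sym_psd L"
  shows "is_arg_min (\<lambda>u. ((z + B *v u) \<bullet> (L *v (z + B *v u)) + u \<bullet> u + c) / 2) (\<lambda>_. True) u
    \<longleftrightarrow> u = - (regulator_gain L B *v z)"
proof -
  define J where "J = (\<lambda>u. ((z + B *v u) \<bullet> (L *v (z + B *v u)) + u \<bullet> u + c) / 2)"
  define N where "N = mat 1 + transpose B ** L ** B"
  define s where "s = - (regulator_gain L B *v z)"
  have inv: "invertible N"
    unfolding N_def by (intro invertible_mat_1_plus_sym_psd sym_psd_congruence L)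
  have "N ** regulator_gain L B = transpose B ** L"
    using invertible_matrix_inv(1)[OF inv]
    by (simp add: regulator_gain_def matrix_mul_assoc flip: N_def)
  then have Ns: "N *v s = - ((transpose B ** L) *v z)"
    by (simp add: s_def vec.neg matrix_vector_mul_assoc)
  have square: "J (s + d) = J s + (d \<bullet> d + (B *v d) \<bullet> (L *v (B *v d))) / 2" for d
  proof -
    \<comment> \<open>Stationarity: the second factor is the gradient of \<open>J\<close> at
      \<open>s\<close>, so the part of \<open>J (s + d)\<close> linear in \<open>d\<close>
      vanishes.\<close>
    have "0 = d \<bullet> (N *v s + (transpose B ** L) *v z)"
      by (simp add: Ns)
    also have "\<dots> = d \<bullet> s + (B *v d) \<bullet> (L *v (B *v s)) + (B *v d) \<bullet> (L *v z)"
      by (simp add: N_def matrix_vector_mult_add_rdistrib inner_add_right inner_transpose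
          del: transpose_matrix_vector flip: matrix_vector_mul_assoc)
    finally show ?thesis
      using sym_psd_inner_commute[OF L, of "B *v d" z]
        sym_psd_inner_commute[OF L, of "B *v d" "B *v s"]
      by (simp add: J_def matrix_vector_right_distrib inner_add_left inner_add_right
          inner_commute[of s d] field_simps)
  qed
  \<comment> \<open>Keeping the term \<open>d \<bullet> d\<close> gives minimality of
    \<open>s\<close> and also forces every minimizer to equal \<open>s\<close>.\<close>
  have bound: "J s + ((v - s) \<bullet> (v - s)) / 2 \<le> J v" for v
    using square[of "v - s"] L by (simp add: sym_psd_def)
  have "is_arg_min J (\<lambda>_. True) u \<longleftrightarrow> u = s"
  proof
    assume "is_arg_min J (\<lambda>_. True) u"
    then have "J u \<le> J s"
      by (simp add: is_arg_min_linorder)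
    with bound[of u] have "(u - s) \<bullet> (u - s) \<le> 0"
      by linarith
    then show "u = s"
      by (metis inner_eq_zero_iff inner_ge_zero order_antisym right_minus_eq)
  next
    assume "u = s"
    moreover have "J s \<le> J v" for v
      using bound[of v] inner_ge_zero[of "v - s"] by linarith
    ultimately show "is_arg_min J (\<lambda>_. True) u"
      by (simp add: is_arg_min_linorder)
  qed
  then show ?thesis
    by (simp add: J_def s_def)
qed

text \<open>The matrix \<open>mat 1 + B ** transpose B ** L\<close> need not be symmetric, so
  semidefiniteness alone does not give its inverse. Multiplying
  \<open>N ** K = transpose B ** L\<close> by \<open>B\<close> from the left gives \<open>B **
  transpose B ** L = B ** K + B ** transpose B ** L ** B ** K\<close>, which makes
  \<open>mat 1 - B ** K\<close> a right inverse.\<close>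

lemma matrix_inv_closed_loop:
  fixes B :: "real^'m^'p"
  assumes L: "sym_psd L"
  shows "invertible (mat 1 + B ** transpose B ** L)"
    and "matrix_inv (mat 1 + B ** transpose B ** L) = mat 1 - B ** regulator_gain L B"
proof -
  define N where "N = mat 1 + transpose B ** L ** B"
  define K where "K = regulator_gain L B"
  have "invertible N"
    unfolding N_def by (intro invertible_mat_1_plus_sym_psd sym_psd_congruence L)
  then have NK: "N ** K = transpose B ** L"
    by (simp add: K_def regulator_gain_def matrix_mul_assoc invertible_matrix_inv flip: N_def)
  have "((mat 1 + B ** transpose B ** L) ** (mat 1 - B ** K)) *v x = mat 1 *v x" for x
  proof -
    have "(B ** transpose B ** L) *v x = (B ** N ** K) *v x"
      by (metis NK matrix_mul_assoc)
    also have "\<dots> = B *v (K *v x) + (B ** transpose B ** L) *v (B *v (K *v x))"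
      by (simp add: N_def matrix_vector_mult_add_rdistrib matrix_vector_right_distrib
          del: transpose_matrix_vector flip: matrix_vector_mul_assoc)
    finally show ?thesis
      by (simp add: matrix_vector_mult_add_rdistrib matrix_vector_mult_diff_rdistrib
          matrix_vector_mult_diff_distrib
          del: transpose_matrix_vector flip: matrix_vector_mul_assoc)
  qed
  then have "(mat 1 + B ** transpose B ** L) ** (mat 1 - B ** K) = mat 1"
    by (simp add: matrix_eq)
  from matrix_inv_eqI[OF this]
  show "invertible (mat 1 + B ** transpose B ** L)"
    "matrix_inv (mat 1 + B ** transpose B ** L) = mat 1 - B ** regulator_gain L B"
    by (simp_all add: K_def)
qed

lemma transpose_closed_loop:
  assumes "sym_psd L"
  shows "transpose (mat 1 + B ** transpose B ** L) = mat 1 + L ** B ** transpose B"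
  using assms by (simp add: sym_psd_def transpose_add matrix_transpose_mul matrix_mul_assoc)

lemma transpose_regulator_gain:
  assumes "sym_psd L"
  shows "transpose (regulator_gain L B) = L ** B ** matrix_inv (mat 1 + transpose B ** L ** B)"
proof -
  define N where "N = mat 1 + transpose B ** L ** B"
  have "invertible N"
    unfolding N_def by (intro invertible_mat_1_plus_sym_psd sym_psd_congruence assms)
  moreover have "transpose N = N"
    using sym_psd_congruence[OF assms, of B] by (simp add: N_def sym_psd_def transpose_add)
  ultimately have "transpose (matrix_inv N) = matrix_inv N"
    by (simp add: transpose_matrix_inv)
  then show ?thesis
    using assms
    by (simp add: regulator_gain_def sym_psd_def matrix_transpose_mul matrix_mul_assoc flip: N_def)
qed

section \<open>The leader's weight and the gain formulas\<close>

definition leader_weight ::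
  "real^'m2^'p \<Rightarrow> real^'m2^'m2 \<Rightarrow> real^'p^'p \<Rightarrow> real^'p^'p \<Rightarrow> real^'p^'p" where
  "leader_weight B2 R12 L1 L2 =
     transpose (mat 1 - B2 ** regulator_gain L2 B2) ** L1 ** (mat 1 - B2 ** regulator_gain L2 B2)
     + transpose (regulator_gain L2 B2) ** R12 ** regulator_gain L2 B2"

lemma sym_psd_leader_weight:
  "sym_psd L1 \<Longrightarrow> sym_psd R12 \<Longrightarrow> sym_psd (leader_weight B2 R12 L1 L2)"
  unfolding leader_weight_def by (intro sym_psd_add sym_psd_congruence)

text \<open>The right factor \<open>mat 1 - B2 ** K\<close>, with the follower's gain
  \<open>K\<close>, is a closed-loop inverse; symmetry of \<open>L2\<close> turns its transpose into
  the inverse with \<open>L2\<close> in front.\<close>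

lemma leader_weight_eq:
  assumes "sym_psd L2"
  shows "leader_weight B2 R12 L1 L2 =
    matrix_inv (mat 1 + L2 ** B2 ** transpose B2) ** L1
      ** matrix_inv (mat 1 + B2 ** transpose B2 ** L2)
    + L2 ** B2 ** matrix_inv (mat 1 + transpose B2 ** L2 ** B2) ** R12
      ** matrix_inv (mat 1 + transpose B2 ** L2 ** B2) ** transpose B2 ** L2"
  using transpose_matrix_inv[OF matrix_inv_closed_loop(1)[OF assms, of B2]]
  by (simp add: leader_weight_def transpose_closed_loop[OF assms] matrix_inv_closed_loop[OF assms]
      transpose_regulator_gain[OF assms]) (simp add: regulator_gain_def matrix_mul_assoc)

text \<open>In this form the bracket is the matrix inverted in a regulator gain, and it is
  invertible whenever the weight is positive semidefinite.\<close>

lemma leader_bracket_eq: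
  assumes "sym_psd L2"
  shows "leader_bracket B1 B2 R12 L1 L2 =
    mat 1 + transpose B1 ** leader_weight B2 R12 L1 L2 ** B1"
  by (simp add: leader_bracket_def leader_weight_eq[OF assms] matrix_add_ldistrib
      matrix_add_rdistrib matrix_mul_assoc)

lemma leader_gain_eq:
  assumes "sym_psd L2"
  shows "leader_gain A B1 B2 R12 L1 L2 = regulator_gain (leader_weight B2 R12 L1 L2) B1 ** A"
  unfolding leader_gain_def leader_bracket_eq[OF assms] regulator_gain_def
  by (simp add: leader_weight_eq[OF assms] matrix_mul_assoc)

lemma follower_gain_eq:
  "follower_gain A B1 B2 L2 S1 = regulator_gain L2 B2 ** (A - B1 ** S1)"
  by (simp add: follower_gain_def regulator_gain_def)

text \<open>\<open>matrix_inv\<close> is defined by choice and is a genuine inverse only for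
  invertible matrices; these facts give the gain formulas their meaning. The first matrix is the
  transpose of the second.\<close>

lemma stage_invertible:
  assumes L2: "sym_psd L2" and L1: "sym_psd L1" and R12: "sym_psd R12"
  shows "invertible (mat 1 + L2 ** B2 ** transpose B2)"
    "invertible (mat 1 + B2 ** transpose B2 ** L2)"
    "invertible (mat 1 + transpose B2 ** L2 ** B2)"
    "invertible (leader_bracket B1 B2 R12 L1 L2)"
proof -
  show *: "invertible (mat 1 + B2 ** transpose B2 ** L2)"
    by (rule matrix_inv_closed_loop[OF L2])
  show "invertible (mat 1 + L2 ** B2 ** transpose B2)"
    using transpose_invertible[OF *] by (simp add: transpose_closed_loop[OF L2])
  show "invertible (mat 1 + transpose B2 ** L2 ** B2)"
    by (intro invertible_mat_1_plus_sym_psd sym_psd_congruence L2)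
  show "invertible (leader_bracket B1 B2 R12 L1 L2)"
    unfolding leader_bracket_eq[OF L2]
    by (intro invertible_mat_1_plus_sym_psd sym_psd_congruence sym_psd_leader_weight L1 R12)
qed

section \<open>Equilibria of a single stage\<close>

definition stage_equilibrium ::
  "('u \<Rightarrow> 'v \<Rightarrow> real) \<Rightarrow> ('u \<Rightarrow> 'v \<Rightarrow> real) \<Rightarrow> 'u \<Rightarrow> 'v \<Rightarrow> bool" where
  "stage_equilibrium J1 J2 g1 g2 \<longleftrightarrow>
    (\<exists>r. (\<forall>u1 u2. is_arg_min (J2 u1) (\<lambda>_. True) u2 \<longleftrightarrow> u2 = r u1) \<and>
         is_arg_min (\<lambda>u1. J1 u1 (r u1)) (\<lambda>_. True) g1 \<and> g2 = r g1)"

text \<open>Both players solve regulator problems: the follower with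
  \<open>z = A *v x + B1 *v u1\<close>, the leader, after substitution of the reaction, with weight
  \<open>W\<close> and \<open>z = A *v x\<close>. Unique minimizers yield an equivalence, which
  serves existence and uniqueness alike.\<close>

lemma stage_equilibrium_iff:
  fixes A L1 L2 :: "real^'p^'p" and B1 :: "real^'m1^'p" and B2 :: "real^'m2^'p"
  assumes L1: "sym_psd L1" and L2: "sym_psd L2" and R12: "sym_psd R12"
    and J1: "\<And>u1 u2. J1 u1 u2 = stage_cost L1 R12 (A *v x + B1 *v u1 + B2 *v u2) u1 u2"
    and J2: "\<And>u1 u2. J2 u1 u2 = stage_cost L2 R21 (A *v x + B1 *v u1 + B2 *v u2) u2 u1"
    and S1: "S1 = leader_gain A B1 B2 R12 L1 L2"
    and S2: "S2 = follower_gain A B1 B2 L2 S1"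
  shows "stage_equilibrium J1 J2 g1 g2 \<longleftrightarrow> g1 = - (S1 *v x) \<and> g2 = - (S2 *v x)"
proof -
  define K where "K = regulator_gain L2 B2"
  define W where "W = leader_weight B2 R12 L1 L2"
  define r0 where "r0 = (\<lambda>u1. - (K *v (A *v x + B1 *v u1)))"
  have follower: "is_arg_min (J2 u1) (\<lambda>_. True) u2 \<longleftrightarrow> u2 = r0 u1" for u1 u2
  proof -
    have "J2 u1 = (\<lambda>u. (((A *v x + B1 *v u1) + B2 *v u) \<bullet> (L2 *v ((A *v x + B1 *v u1) + B2 *v u))
        + u \<bullet> u + u1 \<bullet> (R21 *v u1)) / 2)"
      by (simp add: fun_eq_iff J2 stage_cost_def)
    then show ?thesis
      by (simp only: is_arg_min_regulator[OF L2] r0_def K_def)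
  qed
  \<comment> \<open>The summand \<open>0\<close> stands for the constant \<open>c\<close> of
    \<open>is_arg_min_regulator\<close>.\<close>
  have "J1 u (r0 u) = ((A *v x + B1 *v u) \<bullet> (W *v (A *v x + B1 *v u)) + u \<bullet> u + 0) / 2" for u
  proof -
    define z where "z = A *v x + B1 *v u"
    have next_state: "z + B2 *v r0 u = (mat 1 - B2 ** K) *v z"
      by (simp add: r0_def z_def[symmetric] vec.neg matrix_vector_mult_diff_rdistrib
          flip: matrix_vector_mul_assoc)
    have "z \<bullet> (W *v z) = (z + B2 *v r0 u) \<bullet> (L1 *v (z + B2 *v r0 u)) + r0 u \<bullet> (R12 *v r0 u)"
      unfolding W_def leader_weight_def K_def[symmetric] next_state
        matrix_vector_mult_add_rdistrib inner_add_right inner_congruence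
      by (simp add: r0_def z_def[symmetric] vec.neg)
    then show ?thesis
      by (simp add: J1 stage_cost_def z_def[symmetric])
  qed
  then have "is_arg_min (\<lambda>u. J1 u (r0 u)) (\<lambda>_. True) g1 \<longleftrightarrow>
      g1 = - (regulator_gain W B1 *v (A *v x))"
    by (simp only: is_arg_min_regulator[OF sym_psd_leader_weight[OF L1 R12]] W_def)
  also have "regulator_gain W B1 *v (A *v x) = S1 *v x"
    by (simp add: S1 leader_gain_eq[OF L2] W_def matrix_vector_mul_assoc)
  finally have leader: "is_arg_min (\<lambda>u. J1 u (r0 u)) (\<lambda>_. True) g1 \<longleftrightarrow> g1 = - (S1 *v x)" .
  have reaction: "r0 (- (S1 *v x)) = - (S2 *v x)"
    by (simp add: r0_def S2 follower_gain_eq K_def vec.neg matrix_vector_mult_diff_rdistrib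
        flip: matrix_vector_mul_assoc)
  \<comment> \<open>The reaction function is forced, so the quantifier over \<open>r\<close>
    collapses to \<open>r0\<close>.\<close>
  have "(\<forall>u1 u2. is_arg_min (J2 u1) (\<lambda>_. True) u2 \<longleftrightarrow> u2 = r u1) \<longleftrightarrow> r = r0" for r
    unfolding follower fun_eq_iff by auto
  then show ?thesis
    using leader reaction by (auto simp: stage_equilibrium_def)
qed

section \<open>The cost-to-go recursion\<close>

lemma stage_cost_shift:
  "stage_cost Q R y u v + y \<bullet> ((L - Q) *v y) / 2 = stage_cost L R y u v"
  by (simp add: stage_cost_def matrix_vector_mult_diff_rdistrib inner_diff_right field_simps)

lemma sym_psd_cost_step:
  assumes "sym_psd Q" "sym_psd R" "sym_psd L"
  shows "sym_psd (cost_step Q R F S S' L)"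
  unfolding cost_step_def by (intro sym_psd_add sym_psd_congruence sym_psd_gram assms)

text \<open>Removing the current state cost \<open>Q\<close> leaves the cost of linear feedback with
  successor state \<open>F *v x\<close>; the signs of the controls cancel in the quadratic
  terms.\<close>

lemma inner_cost_step:
  "x \<bullet> ((cost_step Q R F S S' L - Q) *v x) / 2 =
    stage_cost L R (F *v x) (- (S *v x)) (- (S' *v x))"
proof -
  have "x \<bullet> ((transpose S ** S) *v x) = (S *v x) \<bullet> (S *v x)"
    using inner_congruence[of x S "mat 1"] by simp
  then show ?thesis
    by (simp add: cost_step_def stage_cost_def matrix_vector_mult_add_rdistrib inner_add_right
        inner_congruence vec.neg)
qed

section \<open>Backward induction over the stages\<close>

theorem proposition4:
  fixes T :: nat
    and A :: "nat \<Rightarrow> real^'p^'p"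
    and B1 :: "nat \<Rightarrow> real^'m1^'p" and B2 :: "nat \<Rightarrow> real^'m2^'p"
    and Q1 Q2 :: "nat \<Rightarrow> real^'p^'p"
    and R12 :: "nat \<Rightarrow> real^'m2^'m2" and R21 :: "nat \<Rightarrow> real^'m1^'m1"
    and S1 :: "nat \<Rightarrow> real^'p^'m1" and S2 :: "nat \<Rightarrow> real^'p^'m2"
    and L1 L2 :: "nat \<Rightarrow> real^'p^'p"
  assumes "1 \<le> T"
    and "Q1 1 = 0" and "Q2 1 = 0"
    and "\<And>k. k \<in> {1..T} \<Longrightarrow> sym_psd (Q1 (k + 1))"
    and "\<And>k. k \<in> {1..T} \<Longrightarrow> sym_psd (Q2 (k + 1))"
    and "\<And>k. k \<in> {1..T} \<Longrightarrow> sym_psd (R12 k)"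
    and "\<And>k. k \<in> {1..T} \<Longrightarrow> sym_psd (R21 k)"
    and "L1 (T + 1) = Q1 (T + 1)" and "L2 (T + 1) = Q2 (T + 1)"
    and "\<And>k. k \<in> {1..T} \<Longrightarrow>
           S1 k = leader_gain (A k) (B1 k) (B2 k) (R12 k) (L1 (k + 1)) (L2 (k + 1))"
    and "\<And>k. k \<in> {1..T} \<Longrightarrow>
           S2 k = follower_gain (A k) (B1 k) (B2 k) (L2 (k + 1)) (S1 k)"
    and "\<And>k. k \<in> {1..T} \<Longrightarrow>
           L1 k = cost_step (Q1 k) (R12 k) (A k - B1 k ** S1 k - B2 k ** S2 k)
                    (S1 k) (S2 k) (L1 (k + 1))"
    and "\<And>k. k \<in> {1..T} \<Longrightarrow>
           L2 k = cost_step (Q2 k) (R21 k) (A k - B2 k ** S2 k - B1 k ** S1 k)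
                    (S2 k) (S1 k) (L2 (k + 1))"
  shows "(\<forall>k\<in>{1..T}.
            invertible (mat 1 + L2 (k + 1) ** B2 k ** transpose (B2 k)) \<and>
            invertible (mat 1 + B2 k ** transpose (B2 k) ** L2 (k + 1)) \<and>
            invertible (mat 1 + transpose (B2 k) ** L2 (k + 1) ** B2 k) \<and>
            invertible (leader_bracket (B1 k) (B2 k) (R12 k) (L1 (k + 1)) (L2 (k + 1)))) \<and>
         feedback_stackelberg T A B1 B2 Q1 Q2 R12 R21
           (\<lambda>k x. - (S1 k *v x)) (\<lambda>k x. - (S2 k *v x)) \<and>
         (\<forall>\<gamma>1 \<gamma>2. feedback_stackelberg T A B1 B2 Q1 Q2 R12 R21 \<gamma>1 \<gamma>2 \<longrightarrow>
            (\<forall>k\<in>{1..T}. \<forall>x. \<gamma>1 k x = - (S1 k *v x) \<and> \<gamma>2 k x = - (S2 k *v x)))"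
proof -
  \<comment> \<open>The semidefiniteness hypotheses cover the indices \<open>2\<close> to
    \<open>T + 1\<close>; index \<open>1\<close> comes from the convention that the weight there is
    zero.\<close>
  have sym_psd_Q: "sym_psd (Q1 k) \<and> sym_psd (Q2 k)" if "k \<in> {1..T + 1}" for k
  proof (cases "k = 1")
    case True
    moreover have "sym_psd (0 :: real^'p^'p)"
      by (simp add: sym_psd_def transpose_def vec_eq_iff)
    ultimately show ?thesis
      using assms(2,3) by simp
  next
    case False
    with that have "k - 1 \<in> {1..T}" and "k - 1 + 1 = k"
      by auto
    then show ?thesis
      using assms(4,5) by metis
  qed
  have sym_psd_L: "sym_psd (L1 k) \<and> sym_psd (L2 k)" if "1 \<le> k" "k \<le> T + 1" for k
    \<comment> \<open>The bound \<open>k \<le> T + 1\<close> drives the downward induction;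
      \<open>1 \<le> k\<close> remains a premise of each case and places \<open>k\<close> in
      \<open>{1..T}\<close>.\<close>
    using that(2,1)
  proof (induction k rule: inc_induct)
    case base
    then show ?case
      using sym_psd_Q[of "T + 1"] assms(8,9) by simp
  next
    case (step k)
    then have "k \<in> {1..T}"
      by simp
    with step sym_psd_Q[of k] show ?case
      by (simp add: assms(6,7,12,13) sym_psd_cost_step)
  qed
  have next_psd: "sym_psd (L1 (k + 1))" "sym_psd (L2 (k + 1))" if "k \<in> {1..T}" for k
    using sym_psd_L[of "k + 1"] that by auto
  \<comment> \<open>The candidate cost-to-go functions, to be shown the only possible ones on stages
    \<open>1\<close> to \<open>T + 1\<close>.\<close>
  define W1 where "W1 = (\<lambda>k x. x \<bullet> ((L1 k - Q1 k) *v x) / 2)"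
  define W2 where "W2 = (\<lambda>k x. x \<bullet> ((L2 k - Q2 k) *v x) / 2)"
  define f where "f = (\<lambda>k x u1 u2. A k *v x + B1 k *v u1 + B2 k *v u2)"
  define J1 where "J1 = (\<lambda>V k x u1 u2. stage_cost (Q1 (k + 1)) (R12 k) (f k x u1 u2) u1 u2
      + V (k + 1) (f k x u1 u2))"
  define J2 where "J2 = (\<lambda>V k x u1 u2. stage_cost (Q2 (k + 1)) (R21 k) (f k x u1 u2) u2 u1
      + V (k + 1) (f k x u1 u2))"
  \<comment> \<open>The value equations do not involve \<open>r\<close>, so they leave its scope and
    the rest is a \<open>stage_equilibrium\<close>.\<close>
  have stackelberg_iff: "feedback_stackelberg T A B1 B2 Q1 Q2 R12 R21 \<gamma>1 \<gamma>2 \<longleftrightarrow>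
    (\<exists>V1 V2. (\<forall>x. V1 (T + 1) x = 0) \<and> (\<forall>x. V2 (T + 1) x = 0) \<and>
      (\<forall>k\<in>{1..T}. \<forall>x. stage_equilibrium (J1 V1 k x) (J2 V2 k x) (\<gamma>1 k x) (\<gamma>2 k x) \<and>
        V1 k x = J1 V1 k x (\<gamma>1 k x) (\<gamma>2 k x) \<and> V2 k x = J2 V2 k x (\<gamma>1 k x) (\<gamma>2 k x)))"
    for \<gamma>1 \<gamma>2
    unfolding feedback_stackelberg_def stage_equilibrium_def Let_def J1_def J2_def f_def
    by (simp only: ex_simps(1)[symmetric] conj_assoc)
  have W_end: "W1 (T + 1) x = 0" "W2 (T + 1) x = 0" for x
    using assms(8,9) by (simp_all add: W1_def W2_def)
  have J_W: "J1 W1 k x u1 u2 = stage_cost (L1 (k + 1)) (R12 k) (f k x u1 u2) u1 u2"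
    "J2 W2 k x u1 u2 = stage_cost (L2 (k + 1)) (R21 k) (f k x u1 u2) u2 u1" for k x u1 u2
    by (simp_all only: J1_def J2_def W1_def W2_def stage_cost_shift)
  \<comment> \<open>The closed-loop matrices of \<open>L1\<close> and \<open>L2\<close> subtract the
    two feedback terms in opposite orders; both send \<open>x\<close> to the same successor
    state.\<close>
  have W_step: "W1 k x = J1 W1 k x (- (S1 k *v x)) (- (S2 k *v x))"
    "W2 k x = J2 W2 k x (- (S1 k *v x)) (- (S2 k *v x))" if "k \<in> {1..T}" for k x
    unfolding J_W
    unfolding W1_def W2_def assms(12)[OF that] assms(13)[OF that] inner_cost_step f_def
    by (simp_all add: matrix_vector_mult_diff_rdistrib vec.neg algebra_simps
        flip: matrix_vector_mul_assoc)
  have stage: "stage_equilibrium (J1 W1 k x) (J2 W2 k x) g1 g2 \<longleftrightarrow>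
      g1 = - (S1 k *v x) \<and> g2 = - (S2 k *v x)" if "k \<in> {1..T}" for k x g1 g2
    by (rule stage_equilibrium_iff[OF next_psd[OF that] assms(6)[OF that] J_W[unfolded f_def]
          assms(10)[OF that] assms(11)[OF that]])
  have existence: "feedback_stackelberg T A B1 B2 Q1 Q2 R12 R21
      (\<lambda>k x. - (S1 k *v x)) (\<lambda>k x. - (S2 k *v x))"
    unfolding stackelberg_iff
    by (rule exI[of _ W1], rule exI[of _ W2]) (intro conjI allI ballI W_end W_step, simp add: stage)
  have uniqueness: "\<forall>k\<in>{1..T}. \<forall>x. \<gamma>1 k x = - (S1 k *v x) \<and> \<gamma>2 k x = - (S2 k *v x)"
    if "feedback_stackelberg T A B1 B2 Q1 Q2 R12 R21 \<gamma>1 \<gamma>2" for \<gamma>1 \<gamma>2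
  proof -
    obtain V1 V2 where V_end: "\<And>x. V1 (T + 1) x = 0" "\<And>x. V2 (T + 1) x = 0"
      and equilibrium: "\<And>k x. k \<in> {1..T} \<Longrightarrow>
        stage_equilibrium (J1 V1 k x) (J2 V2 k x) (\<gamma>1 k x) (\<gamma>2 k x)"
      and V_step: "\<And>k x. k \<in> {1..T} \<Longrightarrow> V1 k x = J1 V1 k x (\<gamma>1 k x) (\<gamma>2 k x)"
        "\<And>k x. k \<in> {1..T} \<Longrightarrow> V2 k x = J2 V2 k x (\<gamma>1 k x) (\<gamma>2 k x)"
      using \<open>feedback_stackelberg T A B1 B2 Q1 Q2 R12 R21 \<gamma>1 \<gamma>2\<close> unfolding stackelberg_iff by blast
    \<comment> \<open>The costs at stage \<open>k\<close> see the cost-to-go only at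
      \<open>k + 1\<close>.\<close>
    have J_V: "J1 V1 k = J1 W1 k" "J2 V2 k = J2 W2 k"
      if "V1 (k + 1) = W1 (k + 1)" "V2 (k + 1) = W2 (k + 1)" for k
      using that by (simp_all add: J1_def J2_def)
    have gains: "\<gamma>1 k x = - (S1 k *v x)" "\<gamma>2 k x = - (S2 k *v x)"
      if k: "k \<in> {1..T}" and next_V: "V1 (k + 1) = W1 (k + 1)" "V2 (k + 1) = W2 (k + 1)" for k x
      using equilibrium[OF k, of x] stage[OF k] by (simp_all add: J_V[OF next_V])
    \<comment> \<open>Going down from \<open>T + 1\<close>: agreement at \<open>k + 1\<close> forces
      the strategies at \<open>k\<close> through \<open>gains\<close>, and the value equations then
      force agreement at \<open>k\<close>.\<close>
    have V_eq: "V1 k = W1 k \<and> V2 k = W2 k" if "1 \<le> k" "k \<le> T + 1" for k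
      using that(2,1)
    proof (induction k rule: inc_induct)
      case base
      show ?case
        using V_end W_end by (simp add: fun_eq_iff)
    next
      case (step k)
      then have k: "k \<in> {1..T}" and next_V: "V1 (k + 1) = W1 (k + 1)" "V2 (k + 1) = W2 (k + 1)"
        by simp_all
      show ?case
        using V_step[OF k] W_step[OF k] by (simp add: fun_eq_iff J_V[OF next_V] gains[OF k next_V])
    qed
    show ?thesis
      using gains V_eq by simp
  qed
  have inverses: "\<forall>k\<in>{1..T}. invertible (mat 1 + L2 (k + 1) ** B2 k ** transpose (B2 k)) \<and>
      invertible (mat 1 + B2 k ** transpose (B2 k) ** L2 (k + 1)) \<and>
      invertible (mat 1 + transpose (B2 k) ** L2 (k + 1) ** B2 k) \<and>
      invertible (leader_bracket (B1 k) (B2 k) (R12 k) (L1 (k + 1)) (L2 (k + 1)))"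
    by (intro ballI conjI stage_invertible[OF next_psd(2) next_psd(1) assms(6)])
  show ?thesis
    by (intro conjI allI impI inverses existence uniqueness)
qed

end
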